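(* Let $\mathcal{C}_\Pi$ be a K3 model, corresponding to a positive definite four-dimensional subspace $\Pi\subset V\cong\Gamma^{4,20}\otimes\mathbb{R}$. Then the quantum dimension $\langle\mathcal{L}\rangle$ of every defect $\mathcal{L}\in\mathsf{Top}_\Pi$ is an algebraic integer of degree at most $6$. Furthermore, if $\Pi\cap\Gamma^{4,20}\neq 0$, then $\langle\mathcal{L}\rangle$ is an integer for all $\mathcal{L}\in\mathsf{Top}_\Pi$.
   Context: An algebraic integer is a root of a monic polynomial with integer coefficients; its degree is the least degree of such a polynomial. Defects. In a unitary two-dimensional CFT with space of states $\mathcal{H}$ and unique vacuum $|0\rangle$, a topological defect line $\mathcal{L}$ is an oriented line operator whose support can be deformed without changing correlation functions as long as it does not cross other insertions. Wrapping $\mathcal{L}$ around the circle of the cylinder gives a linear operator $\hat{\mathcal{L}}:\mathcal{H}\to\mathcal{H}$, and the quantum dimension is $\langle\mathcal{L}\rangle=\langle 0|\hat{\mathcal{L}}|0\rangle$ (assumed finite; it is a real number $\ge 1$). $\mathcal{L}$ is transparent to a local operator $\phi$ if it can be moved past $\phi$ without changing any correlation function. K3 models. A K3 model is a supersymmetric non-linear sigma model on a K3 surface: a unitary SCFT with small $\mathcal{N}=(4,4)$ superconformal algebra at $c=\tilde c=6$, invariant under spectral flow. The real space $V$ of CPT self-conjugate R-R ground states ($h=\tilde h=\frac14$) has dimension $24$ and splits as $V=\Pi\oplus\Pi^\perp$, with $\Pi$ the $4$-dimensional space of spectral flow generators (in the $\mathcal{N}=(4,4)$ representation with weights $\frac14$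 and $SU(2)$ R-symmetry spins $(\frac12,\frac12)$) and $\Pi^\perp$ the $20$-dimensional space of R-symmetry singlets. $V$ carries a bilinear form of signature $(4,20)$, positive definite on $\Pi$ and negative definite on $\Pi^\perp$, and contains the even unimodular lattice $\Gamma^{4,20}$ of signature $(4,20)$ (dual of the lattice of R-R charges of 1/2-BPS D-branes), with $V\cong\Gamma^{4,20}\otimes\mathbb{R}$. The model determined by $\Pi$ is denoted $\mathcal{C}_\Pi$. $\mathsf{Top}_\Pi$ denotes the category of topological defects of $\mathcal{C}_\Pi$ that are transparent to all currents of the $\mathcal{N}=(4,4)$ superconformal algebra and to the spectral flow generators. For $\mathcal{L}\in\mathsf{Top}_\Pi$, write $\mathsf{L}:=\hat{\mathcal{L}}_{|V}:V\to V$. It has the following properties: (a) since fusion with $\mathcal{L}$ maps 1/2-BPS boundary states to 1/2-BPS boundary states, $\mathsf{L}$ is the $\mathbb{R}$-linear extension of a $\mathbb{Z}$-linear endomorphism of $\Gamma^{4,20}$; (b) $\mathsf{L}(\Pi)\subseteq\Pi$, $\mathsf{L}(\Pi^\perp)\subseteq\Pi^\perp$, and $\mathsf{L}_{|\Pi}=\langle\mathcal{L}\rangle\,\mathrm{id}_\Pi$. *)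

theory Defs
  imports "HOL-Analysis.Analysis" "HOL-Computational_Algebra.Polynomial"
begin

text \<open>
  The axioms below describe the part of a two-dimensional SCFT on the cylinder and the sphere that
  enters the notions ``K3 model'', ``spectral flow generator'', ``R-R ground state'', ``1/2-BPS
  boundary state'', ``transparent topological defect'' and ``quantum dimension''. The state space is
  the algebraic (finite energy) space of states, a complex pre-Hilbert space; states are
  identified with local operators. Higher genus and crossing axioms are not included, so
  the models considered here comprise more than the genuine K3 sigma models.
\<close>

section \<open>Degree of an algebraic integer\<close>

definition alg_int_degree :: "complex \<Rightarrow> nat" where
  "alg_int_degree x =
     (LEAST n. \<exists>p :: int poly. lead_coeff p = 1 \<and> degree p = n \<and> poly (map_poly of_int p) x = 0)"

section \<open>Lattices\<close>

definition lattice_in :: "'v::real_vector set \<Rightarrow> 'v set \<Rightarrow> bool" where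
  "lattice_in V \<Gamma> \<longleftrightarrow>
     (\<exists>B. finite B \<and> independent B \<and> span B = V \<and>
          \<Gamma> = {\<Sum>b\<in>B. of_int (c b) *\<^sub>R b | c :: 'v \<Rightarrow> int. True})"

definition even_unimodular ::
  "('v::real_vector \<Rightarrow> 'v \<Rightarrow> real) \<Rightarrow> 'v set \<Rightarrow> 'v set \<Rightarrow> bool" where
  "even_unimodular q V \<Gamma> \<longleftrightarrow>
     lattice_in V \<Gamma> \<and>
     (\<forall>x\<in>\<Gamma>. \<exists>k::int. q x x = 2 * of_int k) \<and>
     \<Gamma> = {x \<in> V. \<forall>y\<in>\<Gamma>. q x y \<in> \<int>}"

section \<open>The small N = 4 superconformal algebra\<close>

datatype spin = NS | R

text \<open>
  Modes of one chirality. Supercurrent modes are indexed by \<^emph>\<open>twice\<close> the mode number, so that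
  they carry odd indices on the Neveu-Schwarz sector and even indices on the Ramond sector.
  The SU(2) currents have index 1, 2, 3; the supercurrents, and their conjugates, have index 0, 1.
\<close>

record 'h n4 =
  sec :: "spin \<Rightarrow> 'h set"
  Lm :: "int \<Rightarrow> 'h \<Rightarrow> 'h"
  Jm :: "nat \<Rightarrow> int \<Rightarrow> 'h \<Rightarrow> 'h"
  Gm :: "nat \<Rightarrow> int \<Rightarrow> 'h \<Rightarrow> 'h"
  Gbm :: "nat \<Rightarrow> int \<Rightarrow> 'h \<Rightarrow> 'h"

definition smodes :: "spin \<Rightarrow> int set" where
  "smodes s = (case s of NS \<Rightarrow> {t. odd t} | R \<Rightarrow> {t. even t})"

definition pauli :: "nat \<Rightarrow> nat \<Rightarrow> nat \<Rightarrow> complex" where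
  "pauli i a b =
     (if i = 1 then (if a = b then 0 else 1)
      else if i = 2 then (if a = b then 0 else if a = 0 then - \<i> else \<i>)
      else (if a \<noteq> b then 0 else if a = 0 then 1 else - 1))"

text \<open>The Levi-Civita symbol on 1, 2, 3.\<close>

definition levi_civita :: "nat \<Rightarrow> nat \<Rightarrow> nat \<Rightarrow> complex" where
  "levi_civita i j k =
     (of_nat j - of_nat i) * (of_nat k - of_nat j) * (of_nat k - of_nat i) / 2"

definition clinear_op :: "(complex \<Rightarrow> 'h \<Rightarrow> 'h) \<Rightarrow> ('h::real_vector \<Rightarrow> 'h) \<Rightarrow> bool" where
  "clinear_op s f \<longleftrightarrow> (\<forall>x y. f (x + y) = f x + f y) \<and> (\<forall>a x. f (s a x) = s a (f x))"

text \<open>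
  Small N = 4 algebra with c = 6, that is, SU(2) level 1, in the normalization
  \[ \{G^a_r, \bar G^b_s\} = 2\delta^{ab} L_{r+s} - 2(r-s)\sigma^i_{ab}J^i_{r+s}
       + \frac{1}{2}(4r^2-1)\delta^{ab}\delta_{r+s,0}. \]
\<close>

definition n4_algebra :: "(complex \<Rightarrow> 'h \<Rightarrow> 'h) \<Rightarrow> 'h::real_vector n4 \<Rightarrow> bool" where
  "n4_algebra scl A \<longleftrightarrow>
     (\<forall>s. subspace (sec A s) \<and> (\<forall>a. \<forall>x\<in>sec A s. scl a x \<in> sec A s)) \<and>
     (\<forall>m. clinear_op scl (Lm A m) \<and> (\<forall>s. Lm A m ` sec A s \<subseteq> sec A s)) \<and>
     (\<forall>i\<in>{1..3}. \<forall>m. clinear_op scl (Jm A i m) \<and> (\<forall>s. Jm A i m ` sec A s \<subseteq> sec A s)) \<and>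
     (\<forall>a<2. \<forall>t. clinear_op scl (Gm A a t) \<and> clinear_op scl (Gbm A a t)) \<and>
     (\<forall>a<2. \<forall>s. \<forall>t\<in>smodes s. Gm A a t ` sec A s \<subseteq> sec A s \<and> Gbm A a t ` sec A s \<subseteq> sec A s) \<and>
     (\<forall>m n x. Lm A m (Lm A n x) - Lm A n (Lm A m x) =
        scl (of_int (m - n)) (Lm A (m + n) x)
        + (if m + n = 0 then scl (6 / 12 * of_int (m ^ 3 - m)) x else 0)) \<and>
     (\<forall>m n x. \<forall>i\<in>{1..3}. Lm A m (Jm A i n x) - Jm A i n (Lm A m x) =
        scl (of_int (- n)) (Jm A i (m + n) x)) \<and>
     (\<forall>m n x. \<forall>i\<in>{1..3}. \<forall>j\<in>{1..3}. Jm A i m (Jm A j n x) - Jm A j n (Jm A i m x) =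
        (\<Sum>k=1..3. scl (\<i> * levi_civita i j k) (Jm A k (m + n) x))
        + (if i = j \<and> m + n = 0 then scl (of_int m / 2) x else 0)) \<and>
     (\<forall>s. \<forall>x\<in>sec A s. \<forall>t\<in>smodes s. \<forall>a<2. \<forall>m.
        Lm A m (Gm A a t x) - Gm A a t (Lm A m x) =
          scl ((of_int m - of_int t) / 2) (Gm A a (2 * m + t) x) \<and>
        Lm A m (Gbm A a t x) - Gbm A a t (Lm A m x) =
          scl ((of_int m - of_int t) / 2) (Gbm A a (2 * m + t) x) \<and>
        (\<forall>i\<in>{1..3}.
          Jm A i m (Gm A a t x) - Gm A a t (Jm A i m x) =
            (\<Sum>b<2. scl (- pauli i a b / 2) (Gm A b (2 * m + t) x)) \<and>
          Jm A i m (Gbm A a t x) - Gbm A a t (Jm A i m x) =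
            (\<Sum>b<2. scl (cnj (pauli i a b) / 2) (Gbm A b (2 * m + t) x)))) \<and>
     (\<forall>s. \<forall>x\<in>sec A s. \<forall>t\<in>smodes s. \<forall>u\<in>smodes s. \<forall>a<2. \<forall>b<2.
        Gm A a t (Gm A b u x) + Gm A b u (Gm A a t x) = 0 \<and>
        Gbm A a t (Gbm A b u x) + Gbm A b u (Gbm A a t x) = 0 \<and>
        Gm A a t (Gbm A b u x) + Gbm A b u (Gm A a t x) =
          (if a = b then scl 2 (Lm A ((t + u) div 2) x)
             + (if t + u = 0 then scl (of_int (t\<^sup>2 - 1) / 2) x else 0) else 0)
          - scl (of_int (t - u)) (\<Sum>i=1..3. scl (pauli i a b) (Jm A i ((t + u) div 2) x)))"

definition n4_unitary :: "('h \<Rightarrow> 'h \<Rightarrow> complex) \<Rightarrow> 'h n4 \<Rightarrow> bool" where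
  "n4_unitary ip A \<longleftrightarrow>
     (\<forall>x\<in>sec A NS. \<forall>y\<in>sec A R. ip x y = 0) \<and>
     (\<forall>m x y. ip (Lm A m x) y = ip x (Lm A (- m) y)) \<and>
     (\<forall>m x y. \<forall>i\<in>{1..3}. ip (Jm A i m x) y = ip x (Jm A i (- m) y)) \<and>
     (\<forall>s. \<forall>t\<in>smodes s. \<forall>x\<in>sec A s. \<forall>y\<in>sec A s. \<forall>a<2.
        ip (Gm A a t x) y = ip x (Gbm A a (- t) y))"

text \<open>The two chiralities form the direct sum of the two superalgebras.\<close>

definition n4_supercommute :: "'h::real_vector n4 \<Rightarrow> 'h n4 \<Rightarrow> bool" where
  "n4_supercommute A B \<longleftrightarrow>
     (\<forall>X \<in> range (Lm A) \<union> {Jm A i m | i m. i \<in> {1..3}}.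
        (\<forall>Y \<in> range (Lm B) \<union> {Jm B i m | i m. i \<in> {1..3}}. \<forall>x. X (Y x) = Y (X x)) \<and>
        (\<forall>s. X ` sec B s \<subseteq> sec B s) \<and>
        (\<forall>s. \<forall>u\<in>smodes s. \<forall>b<2. \<forall>x\<in>sec B s.
           X (Gm B b u x) = Gm B b u (X x) \<and> X (Gbm B b u x) = Gbm B b u (X x))) \<and>
     (\<forall>s s'. \<forall>t\<in>smodes s. \<forall>a<2. \<forall>X\<in>{Gm A a t, Gbm A a t}.
        X ` (sec A s \<inter> sec B s') \<subseteq> sec B s' \<and>
        (\<forall>u\<in>smodes s'. \<forall>b<2. \<forall>Y\<in>{Gm B b u, Gbm B b u}.
           \<forall>x\<in>sec A s \<inter> sec B s'. X (Y x) = - Y (X x)))"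

text \<open>
  Spectral flow by half a unit along the third direction of SU(2): U is an
  isomorphism from the NS to the R sector inducing the automorphism
  \[ L_n \mapsto L_n + J^3_n + \frac14\delta_{n,0},\quad J^3_n \mapsto J^3_n + \frac12\delta_{n,0},
     \quad J^\pm_n \mapsto J^\pm_{n\pm1},\quad
     G^{1,2}_r \mapsto G^{1,2}_{r \mp 1/2},\quad \bar G^{1,2}_r \mapsto \bar G^{1,2}_{r\pm 1/2}. \]
\<close>

definition spectral_flow ::
  "(complex \<Rightarrow> 'h \<Rightarrow> 'h) \<Rightarrow> 'h::real_vector n4 \<Rightarrow> 'h set \<Rightarrow> ('h \<Rightarrow> 'h) \<Rightarrow> bool" where
  "spectral_flow scl A S U \<longleftrightarrow>
     (\<forall>x\<in>S. \<forall>n.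
        Lm A n (U x) = U (Lm A n x + Jm A 3 n x + (if n = 0 then scl (1 / 4) x else 0)) \<and>
        Jm A 3 n (U x) = U (Jm A 3 n x + (if n = 0 then scl (1 / 2) x else 0)) \<and>
        Jm A 1 n (U x) + scl \<i> (Jm A 2 n (U x)) =
          U (Jm A 1 (n + 1) x + scl \<i> (Jm A 2 (n + 1) x)) \<and>
        Jm A 1 n (U x) - scl \<i> (Jm A 2 n (U x)) =
          U (Jm A 1 (n - 1) x - scl \<i> (Jm A 2 (n - 1) x))) \<and>
     (\<forall>x\<in>S. \<forall>t\<in>smodes R.
        Gm A 0 t (U x) = U (Gm A 0 (t - 1) x) \<and> Gm A 1 t (U x) = U (Gm A 1 (t + 1) x) \<and>
        Gbm A 0 t (U x) = U (Gbm A 0 (t + 1) x) \<and> Gbm A 1 t (U x) = U (Gbm A 1 (t - 1) x))"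

section \<open>Superconformal field theories with boundaries and defects\<close>

text \<open>
  \<^item> \<open>scl\<close>, \<open>ip\<close>, \<open>vac\<close>: complex scalar multiplication, inner product (antilinear in the
    first argument), and vacuum of the space of states \<open>'h\<close>.
  \<^item> \<open>lft\<close>, \<open>rgt\<close>: the modes of the left- and right-moving N = 4 algebras.
  \<^item> \<open>cpt\<close>: CPT conjugation.
  \<^item> \<open>amp \<psi> \<phi> w \<eta>\<close>: the matrix element of the local operator \<open>\<phi>\<close>, inserted at the
    point \<open>w\<close> of (the universal cover of) the cylinder, between the states \<open>\<psi>\<close> and \<open>\<eta>\<close>.
    In terms of the plane coordinate \<open>z = exp w\<close>, the operator inserted is
    \<open>z powr h * cnj z powr h' * \<phi>(z)\<close> for \<open>\<phi>\<close> of weights \<open>(h, h')\<close>.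
  \<^item> \<open>bps\<close>: the 1/2-BPS boundary states, as linear functionals (disk one-point functions).
  \<^item> \<open>bil\<close>: the bilinear form on the space of CPT self-conjugate R-R ground states.
  \<^item> \<open>defects\<close>, \<open>orev\<close>, \<open>hat\<close>: the topological defects, their orientation reversal, and the
    operators obtained by wrapping them around the circle of the cylinder.
\<close>

record ('h, 'd) sigma_model =
  scl :: "complex \<Rightarrow> 'h \<Rightarrow> 'h"
  ip :: "'h \<Rightarrow> 'h \<Rightarrow> complex"
  vac :: 'h
  lft :: "'h n4"
  rgt :: "'h n4"
  cpt :: "'h \<Rightarrow> 'h"
  amp :: "'h \<Rightarrow> 'h \<Rightarrow> complex \<Rightarrow> 'h \<Rightarrow> complex"
  bps :: "('h \<Rightarrow> complex) set"
  bil :: "'h \<Rightarrow> 'h \<Rightarrow> real"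
  defects :: "'d set"
  orev :: "'d \<Rightarrow> 'd"
  hat :: "'d \<Rightarrow> 'h \<Rightarrow> 'h"

definition wt :: "('h::real_vector, 'd) sigma_model \<Rightarrow> real \<Rightarrow> real \<Rightarrow> 'h set" where
  "wt K h h' = {x. Lm (lft K) 0 x = h *\<^sub>R x \<and> Lm (rgt K) 0 x = h' *\<^sub>R x}"

definition bisec :: "('h::real_vector, 'd) sigma_model \<Rightarrow> spin \<Rightarrow> spin \<Rightarrow> 'h set" where
  "bisec K s s' = sec (lft K) s \<inter> sec (rgt K) s'"

definition pre_hilbert :: "('h::real_vector, 'd) sigma_model \<Rightarrow> bool" where
  "pre_hilbert K \<longleftrightarrow>
     (\<forall>r x. scl K (of_real r) x = r *\<^sub>R x) \<and>
     (\<forall>a b x. scl K a (scl K b x) = scl K (a * b) x) \<and>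
     (\<forall>a b x. scl K (a + b) x = scl K a x + scl K b x) \<and>
     (\<forall>a x y. scl K a (x + y) = scl K a x + scl K a y) \<and>
     (\<forall>x y. ip K y x = cnj (ip K x y)) \<and>
     (\<forall>x y z. ip K x (y + z) = ip K x y + ip K x z) \<and>
     (\<forall>a x y. ip K x (scl K a y) = a * ip K x y) \<and>
     (\<forall>x. x \<noteq> 0 \<longrightarrow> 0 < Re (ip K x x))"

text \<open>Discrete spectrum with finite degeneracies, and a unique vacuum.\<close>

definition unique_vacuum_spectrum :: "('h::real_vector, 'd) sigma_model \<Rightarrow> bool" where
  "unique_vacuum_spectrum K \<longleftrightarrow>
     span (\<Union>h h' s s'. wt K h h' \<inter> bisec K s s') = UNIV \<and>
     (\<forall>h h'. \<exists>B. finite B \<and> wt K h h' \<subseteq> span B) \<and>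
     wt K 0 0 = range (\<lambda>a. scl K a (vac K)) \<and>
     ip K (vac K) (vac K) = 1 \<and>
     vac K \<in> bisec K NS NS"

definition spectral_flow_invariant :: "('h::real_vector, 'd) sigma_model \<Rightarrow> bool" where
  "spectral_flow_invariant K \<longleftrightarrow>
     (\<exists>U. clinear_op (scl K) U \<and> bij_betw U (bisec K NS NS) (bisec K R R) \<and>
          (\<forall>x\<in>bisec K NS NS. \<forall>y\<in>bisec K NS NS. ip K (U x) (U y) = ip K x y) \<and>
          spectral_flow (scl K) (lft K) (bisec K NS NS) U \<and>
          spectral_flow (scl K) (rgt K) (bisec K NS NS) U)"

definition cpt_conjugation :: "('h::real_vector, 'd) sigma_model \<Rightarrow> bool" where
  "cpt_conjugation K \<longleftrightarrow>
     (\<forall>x y. cpt K (x + y) = cpt K x + cpt K y) \<and>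
     (\<forall>a x. cpt K (scl K a x) = scl K (cnj a) (cpt K x)) \<and>
     (\<forall>x y. ip K (cpt K x) (cpt K y) = ip K y x) \<and>
     cpt K (vac K) = vac K \<and>
     cpt K ` bisec K R R \<subseteq> bisec K R R \<and>
     (\<forall>A\<in>{lft K, rgt K}. \<forall>x. cpt K (Lm A 0 x) = Lm A 0 (cpt K x) \<and>
        (\<forall>i\<in>{1..3}. cpt K (Jm A i 0 x) = - Jm A i 0 (cpt K x))) \<and>
     (\<forall>x \<in> wt K (1/4) (1/4) \<inter> bisec K R R. cpt K (cpt K x) = x)"

text \<open>
  Local operators on the cylinder: translation covariance, the state-operator correspondence,
  and the mode expansions of the N = 4 currents.
\<close>

definition local_operators :: "('h::real_vector, 'd) sigma_model \<Rightarrow> bool" where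
  "local_operators K \<longleftrightarrow>
     (\<forall>\<psi> \<phi> w. (\<forall>x y. amp K \<psi> \<phi> w (x + y) = amp K \<psi> \<phi> w x + amp K \<psi> \<phi> w y) \<and>
              (\<forall>a x. amp K \<psi> \<phi> w (scl K a x) = a * amp K \<psi> \<phi> w x)) \<and>
     (\<forall>\<psi> \<eta> w. (\<forall>x y. amp K \<psi> (x + y) w \<eta> = amp K \<psi> x w \<eta> + amp K \<psi> y w \<eta>) \<and>
              (\<forall>a x. amp K \<psi> (scl K a x) w \<eta> = a * amp K \<psi> x w \<eta>)) \<and>
     (\<forall>\<phi> \<eta> w. (\<forall>x y. amp K (x + y) \<phi> w \<eta> = amp K x \<phi> w \<eta> + amp K y \<phi> w \<eta>) \<and>
              (\<forall>a x. amp K (scl K a x) \<phi> w \<eta> = cnj a * amp K x \<phi> w \<eta>)) \<and>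
     (\<forall>h h' k k' \<phi> w. \<forall>\<psi>\<in>wt K h h'. \<forall>\<eta>\<in>wt K k k'.
        amp K \<psi> \<phi> w \<eta> =
          exp (w * of_real (h - k) + cnj w * of_real (h' - k')) * amp K \<psi> \<phi> 0 \<eta>) \<and>
     (\<forall>h h'. \<forall>\<psi>\<in>wt K h h'. \<forall>\<phi>\<in>wt K h h'. amp K \<psi> \<phi> 0 (vac K) = ip K \<psi> \<phi>) \<and>
     (\<forall>h h' n w. \<forall>\<psi>\<in>wt K h h'. \<forall>\<eta>\<in>wt K (h + of_int n) h'.
        amp K \<psi> (Lm (lft K) (- 2) (vac K)) w \<eta> = exp (- of_int n * w) * ip K \<psi> (Lm (lft K) n \<eta>) \<and>
        (\<forall>i\<in>{1..3}. amp K \<psi> (Jm (lft K) i (- 1) (vac K)) w \<eta> =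
           exp (- of_int n * w) * ip K \<psi> (Jm (lft K) i n \<eta>))) \<and>
     (\<forall>h h' n w. \<forall>\<psi>\<in>wt K h h'. \<forall>\<eta>\<in>wt K h (h' + of_int n).
        amp K \<psi> (Lm (rgt K) (- 2) (vac K)) w \<eta> =
          exp (- of_int n * cnj w) * ip K \<psi> (Lm (rgt K) n \<eta>) \<and>
        (\<forall>i\<in>{1..3}. amp K \<psi> (Jm (rgt K) i (- 1) (vac K)) w \<eta> =
           exp (- of_int n * cnj w) * ip K \<psi> (Jm (rgt K) i n \<eta>))) \<and>
     (\<forall>s h h' w. \<forall>t\<in>smodes s. \<forall>a<2.
        (\<forall>\<psi>\<in>wt K h h'. \<forall>\<eta>\<in>wt K (h + of_int t / 2) h' \<inter> sec (lft K) s.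
           amp K \<psi> (Gm (lft K) a (- 3) (vac K)) w \<eta> =
             exp (- of_int t / 2 * w) * ip K \<psi> (Gm (lft K) a t \<eta>) \<and>
           amp K \<psi> (Gbm (lft K) a (- 3) (vac K)) w \<eta> =
             exp (- of_int t / 2 * w) * ip K \<psi> (Gbm (lft K) a t \<eta>)) \<and>
        (\<forall>\<psi>\<in>wt K h h'. \<forall>\<eta>\<in>wt K h (h' + of_int t / 2) \<inter> sec (rgt K) s.
           amp K \<psi> (Gm (rgt K) a (- 3) (vac K)) w \<eta> =
             exp (- of_int t / 2 * cnj w) * ip K \<psi> (Gm (rgt K) a t \<eta>) \<and>
           amp K \<psi> (Gbm (rgt K) a (- 3) (vac K)) w \<eta> =
             exp (- of_int t / 2 * cnj w) * ip K \<psi> (Gbm (rgt K) a t \<eta>)))"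

text \<open>The states corresponding to the currents of the N = (4,4) algebra.\<close>

definition n4_currents :: "('h::real_vector, 'd) sigma_model \<Rightarrow> 'h set" where
  "n4_currents K =
     (\<Union>A\<in>{lft K, rgt K}.
        {Lm A (- 2) (vac K)} \<union> {Jm A i (- 1) (vac K) | i. i \<in> {1..3}} \<union>
        {Gm A a (- 3) (vac K) | a. a < 2} \<union> {Gbm A a (- 3) (vac K) | a. a < 2})"

section \<open>Ramond-Ramond ground states and charges\<close>

definition Vspace :: "('h::real_vector, 'd) sigma_model \<Rightarrow> 'h set" where
  "Vspace K = {v \<in> wt K (1/4) (1/4) \<inter> bisec K R R. cpt K v = v}"

text \<open>Spins (1/2, 1/2) are expressed through the two SU(2) Casimir operators, \<open>j * (j + 1) = 3/4\<close>.\<close>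

definition Pi_space :: "('h::real_vector, 'd) sigma_model \<Rightarrow> 'h set" where
  "Pi_space K = {v \<in> Vspace K. \<forall>A\<in>{lft K, rgt K}.
     (\<Sum>i=1..3. Jm A i 0 (Jm A i 0 v)) = (3/4) *\<^sub>R v}"

definition Pi_perp :: "('h::real_vector, 'd) sigma_model \<Rightarrow> 'h set" where
  "Pi_perp K = {v \<in> Vspace K. \<forall>A\<in>{lft K, rgt K}. \<forall>i\<in>{1..3}. Jm A i 0 v = 0}"

text \<open>The R-R charge of a boundary state \<open>b\<close> is its restriction to \<open>Vspace K\<close>; this is the dual of
  the lattice of charges.\<close>

definition RR_lattice :: "('h::real_vector, 'd) sigma_model \<Rightarrow> 'h set" where
  "RR_lattice K = {v \<in> Vspace K. \<forall>b\<in>bps K. b v \<in> \<int>}"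

definition scur :: "'h n4 \<Rightarrow> nat \<Rightarrow> int \<Rightarrow> 'h \<Rightarrow> 'h" where
  "scur A j t = (if j < 2 then Gm A j t else Gbm A (j - 2) t)"

text \<open>A boundary state is conformal and glues the four left-moving to the four right-moving
  supercurrents.\<close>

definition half_BPS :: "('h::real_vector, 'd) sigma_model \<Rightarrow> ('h \<Rightarrow> complex) \<Rightarrow> bool" where
  "half_BPS K b \<longleftrightarrow>
     (\<forall>x y. b (x + y) = b x + b y) \<and> (\<forall>a x. b (scl K a x) = a * b x) \<and>
     (\<forall>n x. b (Lm (lft K) n x) = b (Lm (rgt K) (- n) x)) \<and>
     (\<forall>s. \<exists>M :: nat \<Rightarrow> nat \<Rightarrow> complex. \<forall>t\<in>smodes s. \<forall>x\<in>bisec K s s. \<forall>j<4.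
        b (scur (lft K) j t x) = (\<Sum>k<4. M j k * b (scur (rgt K) k (- t) x)))"

definition RR_structure :: "('h::real_vector, 'd) sigma_model \<Rightarrow> bool" where
  "RR_structure K \<longleftrightarrow>
     dim (Vspace K) = 24 \<and> dim (Pi_space K) = 4 \<and> dim (Pi_perp K) = 20 \<and>
     (\<forall>v\<in>Vspace K. \<exists>!p. fst p \<in> Pi_space K \<and> snd p \<in> Pi_perp K \<and> v = fst p + snd p) \<and>
     (\<forall>x\<in>Vspace K. \<forall>y\<in>Vspace K. bil K x y = bil K y x) \<and>
     (\<forall>x\<in>Vspace K. \<forall>y\<in>Vspace K. \<forall>z\<in>Vspace K. bil K x (y + z) = bil K x y + bil K x z) \<and>
     (\<forall>x\<in>Vspace K. \<forall>y\<in>Vspace K. \<forall>r. bil K x (r *\<^sub>R y) = r * bil K x y) \<and>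
     (\<forall>x\<in>Pi_space K. x \<noteq> 0 \<longrightarrow> bil K x x > 0) \<and>
     (\<forall>x\<in>Pi_perp K. x \<noteq> 0 \<longrightarrow> bil K x x < 0) \<and>
     (\<forall>x\<in>Pi_space K. \<forall>y\<in>Pi_perp K. bil K x y = 0) \<and>
     (\<forall>b\<in>bps K. half_BPS K b) \<and>
     (\<forall>b\<in>bps K. \<forall>v\<in>Vspace K. b v \<in> \<real>) \<and>
     even_unimodular (bil K) (Vspace K) (RR_lattice K)"

section \<open>Topological defects\<close>

definition qdim :: "('h, 'd) sigma_model \<Rightarrow> 'd \<Rightarrow> complex" where
  "qdim K d = ip K (vac K) (hat K d (vac K))"

text \<open>Topological defects commute with the stress tensor; reversing the orientation gives the
  adjoint operator.\<close>

definition topological_defects :: "('h::real_vector, 'd) sigma_model \<Rightarrow> bool" where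
  "topological_defects K \<longleftrightarrow>
     (\<forall>d\<in>defects K.
        clinear_op (scl K) (hat K d) \<and>
        (\<forall>A\<in>{lft K, rgt K}. \<forall>n x. hat K d (Lm A n x) = Lm A n (hat K d x)) \<and>
        orev K d \<in> defects K \<and> orev K (orev K d) = d \<and>
        (\<forall>x y. ip K (hat K (orev K d) x) y = ip K x (hat K d y)) \<and>
        qdim K d \<in> \<real> \<and> 1 \<le> Re (qdim K d))"

text \<open>The circle around which \<open>d\<close> is wrapped can be moved through the local operator \<open>\<phi>\<close>,
  wherever \<open>\<phi>\<close> is inserted and for all other insertions, which prepare the states \<open>\<psi>\<close>
  and \<open>\<eta>\<close>.\<close>

definition transparent :: "('h, 'd) sigma_model \<Rightarrow> 'd \<Rightarrow> 'h \<Rightarrow> bool" where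
  "transparent K d \<phi> \<longleftrightarrow>
     (\<forall>\<psi> w \<eta>. amp K (hat K (orev K d) \<psi>) \<phi> w \<eta> = amp K \<psi> \<phi> w (hat K d \<eta>))"

definition Top :: "('h::real_vector, 'd) sigma_model \<Rightarrow> 'd set" where
  "Top K = {d \<in> defects K. \<forall>\<phi> \<in> n4_currents K \<union> Pi_space K. transparent K d \<phi>}"

text \<open>These defects act on the CPT self-conjugate R-R ground states, and fusion with them maps
  1/2-BPS boundary states to 1/2-BPS boundary states.\<close>

definition Top_actions :: "('h::real_vector, 'd) sigma_model \<Rightarrow> bool" where
  "Top_actions K \<longleftrightarrow>
     (\<forall>d\<in>Top K. hat K d ` Vspace K \<subseteq> Vspace K \<and> (\<forall>b\<in>bps K. b \<circ> hat K d \<in> bps K))"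

definition K3_model :: "('h::real_vector, 'd) sigma_model \<Rightarrow> bool" where
  "K3_model K \<longleftrightarrow>
     pre_hilbert K \<and>
     n4_algebra (scl K) (lft K) \<and> n4_algebra (scl K) (rgt K) \<and>
     n4_unitary (ip K) (lft K) \<and> n4_unitary (ip K) (rgt K) \<and>
     n4_supercommute (lft K) (rgt K) \<and> n4_supercommute (rgt K) (lft K) \<and>
     unique_vacuum_spectrum K \<and> spectral_flow_invariant K \<and> cpt_conjugation K \<and>
     local_operators K \<and> RR_structure K \<and> topological_defects K \<and> Top_actions K"


section \<open>Action of the defects on the lattice and on the R-R ground states\<close>

text \<open>Consequences of the axioms: the operators of the defects in \<open>Top K\<close> restrict to
  endomorphisms of the lattice, multiply the spectral flow generators by the quantum dimension, and
  preserve the space of R-symmetry singlets.\<close>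

lemma n4_algebraD:
  assumes "n4_algebra s A"
  shows "clinear_op s (Lm A m)"
    and "i \<in> {1..3} \<Longrightarrow> clinear_op s (Jm A i m)"
    and "i \<in> {1..3} \<Longrightarrow> Lm A m (Jm A i n x) - Jm A i n (Lm A m x) = s (of_int (- n)) (Jm A i (m + n) x)"
proof -
  note a = assms[unfolded n4_algebra_def]
  show "clinear_op s (Lm A m)"
    by (rule a[THEN conjunct2, THEN conjunct1, rule_format, THEN conjunct1])
  show "i \<in> {1..3} \<Longrightarrow> clinear_op s (Jm A i m)"
    by (rule a[THEN conjunct2, THEN conjunct2, THEN conjunct1, rule_format, THEN conjunct1])
  show "i \<in> {1..3} \<Longrightarrow> Lm A m (Jm A i n x) - Jm A i n (Lm A m x) = s (of_int (- n)) (Jm A i (m + n) x)"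
    by (rule a[THEN conjunct2, THEN conjunct2, THEN conjunct2, THEN conjunct2, THEN conjunct2,
          THEN conjunct2, THEN conjunct1, rule_format])
qed

lemma n4_supercommuteD:
  assumes "n4_supercommute A B"
    and "X \<in> range (Lm A) \<union> {Jm A i m | i m. i \<in> {1..3}}"
    and "Y \<in> range (Lm B) \<union> {Jm B i m | i m. i \<in> {1..3}}"
  shows "X (Y x) = Y (X x)"
  using assms(1)[unfolded n4_supercommute_def, THEN conjunct1, THEN bspec, OF assms(2),
      THEN conjunct1, THEN bspec, OF assms(3)] by (rule spec)

lemma local_operatorsD:
  assumes "local_operators K"
  shows "amp K \<psi> \<phi> w (scl K a x) = a * amp K \<psi> \<phi> w x"
    and "\<psi> \<in> wt K h h' \<Longrightarrow> \<phi> \<in> wt K h h' \<Longrightarrow> amp K \<psi> \<phi> 0 (vac K) = ip K \<psi> \<phi>"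
    and "A \<in> {lft K, rgt K} \<Longrightarrow> i \<in> {1..3} \<Longrightarrow> \<psi> \<in> wt K h h' \<Longrightarrow> \<eta> \<in> wt K h h' \<Longrightarrow>
          amp K \<psi> (Jm A i (- 1) (vac K)) 0 \<eta> = ip K \<psi> (Jm A i 0 \<eta>)"
proof -
  note a = assms[unfolded local_operators_def]
  note a4 = a[THEN conjunct2, THEN conjunct2, THEN conjunct2, THEN conjunct2]
  show "amp K \<psi> \<phi> w (scl K a x) = a * amp K \<psi> \<phi> w x"
    by (rule a[THEN conjunct1, rule_format, THEN conjunct2, rule_format])
  show "\<psi> \<in> wt K h h' \<Longrightarrow> \<phi> \<in> wt K h h' \<Longrightarrow> amp K \<psi> \<phi> 0 (vac K) = ip K \<psi> \<phi>"
    by (rule a4[THEN conjunct1, rule_format])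
  assume A: "A \<in> {lft K, rgt K}" and i: "i \<in> {1..3}"
    and p: "\<psi> \<in> wt K h h'" and e: "\<eta> \<in> wt K h h'"
  have e': "\<eta> \<in> wt K (h + of_int 0) h'" "\<eta> \<in> wt K h (h' + of_int 0)"
    using e by simp_all
  note L = a4[THEN conjunct2, THEN conjunct1, THEN spec[of _ h], THEN spec[of _ h'], THEN spec[of _ 0],
      THEN spec[of _ 0], THEN bspec, OF p, THEN bspec, OF e'(1), THEN conjunct2, THEN bspec, OF i]
  note R = a4[THEN conjunct2, THEN conjunct2, THEN conjunct1, THEN spec[of _ h], THEN spec[of _ h'],
      THEN spec[of _ 0], THEN spec[of _ 0], THEN bspec, OF p, THEN bspec, OF e'(2), THEN conjunct2,
      THEN bspec, OF i]
  show "amp K \<psi> (Jm A i (- 1) (vac K)) 0 \<eta> = ip K \<psi> (Jm A i 0 \<eta>)"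
    using A L R by auto
qed

lemma pre_hilbertD:
  assumes "pre_hilbert K"
  shows "scl K (of_real r) x = r *\<^sub>R x" and "scl K a (scl K b x) = scl K (a * b) x"
    and "ip K x (y + z) = ip K x y + ip K x z" and "ip K x (scl K a y) = a * ip K x y"
    and "x \<noteq> 0 \<Longrightarrow> 0 < Re (ip K x x)"
  using assms unfolding pre_hilbert_def by blast+

lemma n4_K: "K3_model K \<Longrightarrow> A \<in> {lft K, rgt K} \<Longrightarrow> n4_algebra (scl K) A"
  unfolding K3_model_def by blast

lemma Top_RR_lattice:
  assumes K: "K3_model K" and d: "d \<in> Top K"
  shows "hat K d ` RR_lattice K \<subseteq> RR_lattice K"
proof -
  have "Top_actions K" using K by (simp add: K3_model_def)
  then have V: "hat K d ` Vspace K \<subseteq> Vspace K" and b: "\<And>b. b \<in> bps K \<Longrightarrow> b \<circ> hat K d \<in> bps K"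
    using d by (auto simp: Top_actions_def)
  show ?thesis
    using V b unfolding RR_lattice_def by (force simp: image_subset_iff)
qed

context
  fixes K :: "('h::real_vector, 'd) sigma_model" and d :: 'd
  assumes K: "K3_model K" and d: "d \<in> Top K"
begin

lemma Top_defect:
  shows "d \<in> defects K" "orev K d \<in> defects K"
    "e \<in> defects K \<Longrightarrow> clinear_op (scl K) (hat K e)"
    "e \<in> defects K \<Longrightarrow> ip K (hat K (orev K e) x) y = ip K x (hat K e y)"
    "\<And>A n. e \<in> defects K \<Longrightarrow> A \<in> {lft K, rgt K} \<Longrightarrow> hat K e (Lm A n x) = Lm A n (hat K e x)"
proof -
  have T: "topological_defects K" using K by (simp add: K3_model_def)
  show D: "d \<in> defects K" using d by (simp add: Top_def)
  show "orev K d \<in> defects K" using D T unfolding topological_defects_def by blast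
  show "e \<in> defects K \<Longrightarrow> clinear_op (scl K) (hat K e)"
    using T unfolding topological_defects_def by blast
  show "e \<in> defects K \<Longrightarrow> ip K (hat K (orev K e) x) y = ip K x (hat K e y)"
    using T unfolding topological_defects_def by blast
  show "\<And>A n. e \<in> defects K \<Longrightarrow> A \<in> {lft K, rgt K} \<Longrightarrow> hat K e (Lm A n x) = Lm A n (hat K e x)"
    using T unfolding topological_defects_def by blast
qed

lemma hilb: "pre_hilbert K"
  using K by (simp add: K3_model_def)

lemma hat_scaleR:
  assumes "e \<in> defects K" shows "hat K e (r *\<^sub>R x) = r *\<^sub>R hat K e x"
proof -
  have s: "r *\<^sub>R y = scl K (of_real r) y" for y
    by (simp add: pre_hilbertD(1)[OF hilb])
  show ?thesis
    unfolding s using Top_defect(3)[OF assms] by (auto simp: clinear_op_def)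
qed

lemma hat_wt:
  assumes e: "e \<in> defects K" and x: "x \<in> wt K h h'" shows "hat K e x \<in> wt K h h'"
  using x hat_scaleR[OF e]
  by (simp add: wt_def Top_defect(5)[OF e, symmetric])

lemma ip_eqI:
  assumes x: "x \<in> wt K h h'" and y: "y \<in> wt K h h'"
    and e: "\<And>z. z \<in> wt K h h' \<Longrightarrow> ip K z x = ip K z y"
  shows "x = y"
proof (rule ccontr)
  assume "x \<noteq> y"
  have clin: "clinear_op (scl K) (Lm (lft K) 0)" "clinear_op (scl K) (Lm (rgt K) 0)"
    using K by (auto intro!: n4_algebraD(1) n4_K)
  have add: "ip K z (u + v) = ip K z u + ip K z v" for z u v
    by (rule pre_hilbertD[OF hilb])
  have Ldiff: "Lm A 0 (x - y) = Lm A 0 x - Lm A 0 y" if "clinear_op (scl K) (Lm A 0)" for A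
    using that unfolding clinear_op_def by (metis add_diff_cancel diff_add_cancel)
  have diff: "ip K z (x - y) = ip K z x - ip K z y" for z
    using add[of z "x - y" y] by simp
  have w: "x - y \<in> wt K h h'"
    using x y by (simp add: wt_def Ldiff clin scaleR_diff_right)
  have "ip K (x - y) (x - y) = ip K (x - y) x - ip K (x - y) y"
    by (rule diff)
  also have "\<dots> = 0" using e[OF w] by simp
  finally show False
    using pre_hilbertD(5)[OF hilb, of "x - y"] \<open>x \<noteq> y\<close> by simp
qed

lemma hat_vac: "hat K d (vac K) = scl K (qdim K d) (vac K)"
proof -
  have U: "unique_vacuum_spectrum K" using K by (simp add: K3_model_def)
  have o: "scl K 1 x = x" for x
    using pre_hilbertD(1)[OF hilb, of 1] by simp
  have "vac K \<in> wt K 0 0"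
    using U o unfolding unique_vacuum_spectrum_def by (metis rangeI)
  then have "hat K d (vac K) \<in> wt K 0 0"
    by (rule hat_wt[OF Top_defect(1)])
  then obtain a where a: "hat K d (vac K) = scl K a (vac K)"
    using U unfolding unique_vacuum_spectrum_def by auto
  have "qdim K d = a * ip K (vac K) (vac K)"
    by (simp add: qdim_def a pre_hilbertD(4)[OF hilb])
  then have "qdim K d = a"
    using U by (simp add: unique_vacuum_spectrum_def)
  then show ?thesis using a by simp
qed

lemma Top_Pi:
  assumes v: "v \<in> Pi_space K"
  shows "hat K d v = scl K (qdim K d) v"
proof (rule ip_eqI)
  have loc: "local_operators K" using K by (simp add: K3_model_def)
  show w: "hat K d v \<in> wt K (1/4) (1/4)"
    using v by (intro hat_wt Top_defect) (auto simp: Pi_space_def Vspace_def)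
  have v': "v \<in> wt K (1/4) (1/4)"
    using v by (auto simp: Pi_space_def Vspace_def)
  have clin: "clinear_op (scl K) (Lm (lft K) 0)" "clinear_op (scl K) (Lm (rgt K) 0)"
    using K by (auto intro!: n4_algebraD(1) n4_K)
  have cs: "scl K a (r *\<^sub>R u) = r *\<^sub>R scl K a u" for a r u
    by (simp add: pre_hilbertD[OF hilb] mult.commute flip: pre_hilbertD(1)[OF hilb])
  show "scl K (qdim K d) v \<in> wt K (1/4) (1/4)"
    using v' clin cs by (auto simp: wt_def clinear_op_def)
  fix z assume z: "z \<in> wt K (1/4) (1/4)"
  have z': "hat K (orev K d) z \<in> wt K (1/4) (1/4)"
    using z by (intro hat_wt Top_defect)
  have so: "amp K u v 0 (vac K) = ip K u v" if "u \<in> wt K (1/4) (1/4)" for u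
    by (rule local_operatorsD(2)[OF loc that v'])
  have am: "amp K u p 0 (scl K a x) = a * amp K u p 0 x" for u p a x
    by (rule local_operatorsD(1)[OF loc])
  have t: "transparent K d v"
    using d v by (simp add: Top_def)
  have "ip K z (hat K d v) = amp K (hat K (orev K d) z) v 0 (vac K)"
    using so[OF z'] Top_defect(4)[OF Top_defect(1)] by simp
  also have "\<dots> = amp K z v 0 (scl K (qdim K d) (vac K))"
    using t by (simp add: transparent_def hat_vac)
  also have "\<dots> = qdim K d * ip K z v"
    by (simp add: am so[OF z])
  also have "\<dots> = ip K z (scl K (qdim K d) v)"
    by (simp add: pre_hilbertD(4)[OF hilb])
  finally show "ip K z (hat K d v) = ip K z (scl K (qdim K d) v)" .
qed

lemma Top_Pi_perp:
  assumes v: "v \<in> Pi_perp K"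
  shows "hat K d v \<in> Pi_perp K"
proof -
  have loc: "local_operators K" using K by (simp add: K3_model_def)
  have TA: "Top_actions K" using K by (simp add: K3_model_def)
  have tv: "hat K d v \<in> Vspace K"
    using TA d v unfolding Top_actions_def Pi_perp_def by blast
  have v': "v \<in> wt K (1/4) (1/4)" and w: "hat K d v \<in> wt K (1/4) (1/4)"
    using v tv by (auto simp: Pi_perp_def Vspace_def)
  have S: "n4_supercommute (lft K) (rgt K)" using K by (simp add: K3_model_def)
  have "Jm A i 0 (hat K d v) = 0" if A: "A \<in> {lft K, rgt K}" and i: "i \<in> {1..3}" for A i
  proof -
    have clin: "clinear_op (scl K) (Jm A i 0)"
      by (rule n4_algebraD(2)[OF n4_K[OF K A] i])
    have cm1: "Lm A m (Jm A i n x) - Jm A i n (Lm A m x) = scl K (of_int (- n)) (Jm A i (m + n) x)" for m n x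
      by (rule n4_algebraD(3)[OF n4_K[OF K A] i])
    have z0: "scl K 0 x = 0" for x
      using pre_hilbertD(1)[OF hilb, of 0] by simp
    have c1: "Lm A 0 (Jm A i 0 x) = Jm A i 0 (Lm A 0 x)" for x
      using cm1[of 0 0 x] by (simp add: z0)
    have c2: "Lm B 0 (Jm A i 0 x) = Jm A i 0 (Lm B 0 x)" if B: "B \<in> {lft K, rgt K}" for B x
    proof (cases "B = A")
      case True then show ?thesis using c1 by simp
    next
      case False
      then consider "A = lft K" "B = rgt K" | "A = rgt K" "B = lft K" using A B by blast
      then show ?thesis
      proof cases
        case 1
        have "Jm (lft K) i 0 (Lm (rgt K) 0 x) = Lm (rgt K) 0 (Jm (lft K) i 0 x)"
          by (rule n4_supercommuteD[OF S]) (use i in blast)+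
        then show ?thesis using 1 by simp
      next
        case 2
        have "Lm (lft K) 0 (Jm (rgt K) i 0 x) = Jm (rgt K) i 0 (Lm (lft K) 0 x)"
          by (rule n4_supercommuteD[OF S]) (use i in blast)+
        then show ?thesis using 2 by simp
      qed
    qed
    have Jr: "Jm A i 0 (r *\<^sub>R x) = r *\<^sub>R Jm A i 0 x" for r x
      using clin unfolding clinear_op_def by (simp flip: pre_hilbertD(1)[OF hilb])
    have Jw: "Jm A i 0 x \<in> wt K (1/4) (1/4)" if "x \<in> wt K (1/4) (1/4)" for x
      using that c2 Jr by (auto simp: wt_def)
    have zero: "Jm A i 0 v = 0" using v A i by (auto simp: Pi_perp_def)
    have h0: "hat K d 0 = 0" using hat_scaleR[OF Top_defect(1), of 0 0] by simp
    have cur: "Jm A i (- 1) (vac K) \<in> n4_currents K"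
      using A i by (auto simp: n4_currents_def)
    have t: "transparent K d (Jm A i (- 1) (vac K))"
      using d cur by (simp add: Top_def)
    note me = local_operatorsD(3)[OF loc A i]
    have "Jm A i 0 (hat K d v) = hat K d (Jm A i 0 v)"
    proof (rule ip_eqI)
      show "Jm A i 0 (hat K d v) \<in> wt K (1/4) (1/4)" using Jw w by blast
      show "hat K d (Jm A i 0 v) \<in> wt K (1/4) (1/4)" using Jw v' hat_wt Top_defect(1) by blast
      fix z assume z: "z \<in> wt K (1/4) (1/4)"
      have "ip K z (Jm A i 0 (hat K d v)) = amp K z (Jm A i (- 1) (vac K)) 0 (hat K d v)"
        using me z w by simp
      also have "\<dots> = amp K (hat K (orev K d) z) (Jm A i (- 1) (vac K)) 0 v"
        using t by (simp add: transparent_def)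
      also have "\<dots> = ip K (hat K (orev K d) z) (Jm A i 0 v)"
        using me v' z hat_wt Top_defect(2) by blast
      also have "\<dots> = ip K z (hat K d (Jm A i 0 v))"
        using Top_defect(4)[OF Top_defect(1)] .
      finally show "ip K z (Jm A i 0 (hat K d v)) = ip K z (hat K d (Jm A i 0 v))" .
    qed
    then show ?thesis using zero h0 by simp
  qed
  then show ?thesis using tv by (auto simp: Pi_perp_def)
qed

end

end

theory Submission
  imports Defs "Jordan_Normal_Form.Char_Poly"
begin

text \<open>
  Let \<open>l\<close> be the quantum dimension of a defect. Expand four independent vectors of the spectral flow
  space, all of them eigenvectors with eigenvalue \<open>l\<close>, in a basis of the lattice. The 24 columns of
  the resulting \<open>4 \<times> 24\<close> coefficient matrix span \<open>\<real>\<^sup>4\<close>, and multiplication by \<open>l\<close> acts on them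
  through an integer matrix. So \<open>l\<close> is an algebraic integer, and the rational span of the columns is
  stable under \<open>l\<close>. If \<open>l\<close> has degree \<open>n\<close> and \<open>y\<close> runs over four real-independent columns, the \<open>4 n\<close>
  vectors \<open>l\<^sup>j y\<close> with \<open>j < n\<close> are rationally independent in this span, whence \<open>4 n \<le> 24\<close>.
  If a nonzero lattice vector is an eigenvector, comparing coordinates shows that \<open>l\<close> is rational.
\<close>

section \<open>Algebraic integers and integer polynomials\<close>

text \<open>By Gauss' lemma, an integer polynomial of minimal degree annihilating an algebraic integer
  is, up to its content and sign, monic; the division in the proof is a pseudo-division.\<close>

lemma alg_int_degree_le_degree:
  fixes x :: complex and p :: "int poly"
  assumes x: "algebraic_int x" and p: "p \<noteq> 0" "poly (map_poly of_int p) x = 0"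
  shows "alg_int_degree x \<le> degree p"
proof -
  define S where "S = (\<lambda>p :: int poly. p \<noteq> 0 \<and> poly (map_poly of_int p) x = 0)"
  define m where "m = arg_min degree S"
  have m: "S m" and m_le: "\<And>p. S p \<Longrightarrow> degree m \<le> degree p"
    unfolding m_def using arg_min_nat_lemma[of S p degree] arg_min_nat_le[of S _ degree] p
    by (auto simp: S_def)
  obtain q :: "int poly" where q: "poly (map_poly of_int q) x = 0" "lead_coeff q = 1"
    using x by (auto simp: algebraic_int_altdef_ipoly)
  obtain a s where a: "a \<noteq> 0" and s: "Polynomial.smult a q = m * s + pseudo_mod q m"
    using pseudo_mod(1)[of m q] m by (auto simp: S_def)
  have "poly (map_poly of_int (pseudo_mod q m)) x
      = poly (map_poly of_int (Polynomial.smult a q - m * s)) x"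
    using s by simp
  also have "\<dots> = 0"
    using q m by (simp add: S_def of_int_poly_hom.hom_minus of_int_poly_hom.hom_mult of_int_hom.map_poly_hom_smult)
  finally have "pseudo_mod q m = 0 \<or> S (pseudo_mod q m)"
    by (simp add: S_def)
  \<comment> \<open>The pseudo-remainder vanishes at \<open>x\<close> and, if nonzero, has smaller
    degree than \<open>m\<close>, against minimality.\<close>
  then have "pseudo_mod q m = 0"
    using pseudo_mod(2)[of m q] m m_le[of "pseudo_mod q m"] by (auto simp: S_def)
  with s have s: "Polynomial.smult a q = m * s" by simp
  \<comment> \<open>The monic \<open>q\<close> is primitive, so passing to primitive parts leaves
    only the sign of \<open>a\<close>. Comparing leading coefficients then makes that of
    \<open>primitive_part m\<close> a unit.\<close>
  have "content q dvd 1"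
    using content_dvd_coeff[of q "degree q"] q(2) by simp
  then have "content q = 1"
    by (metis is_unit_normalize normalize_content)
  then have "primitive_part (Polynomial.smult a q) = Polynomial.smult (unit_factor a) q"
    by (simp add: primitive_part_smult primitive_part_prim)
  then have "Polynomial.smult (unit_factor a) q = primitive_part m * primitive_part s"
    using s by (simp add: primitive_part_mult)
  then have *: "lead_coeff (Polynomial.smult (unit_factor a) q)
      = lead_coeff (primitive_part m * primitive_part s)"
    by (simp only:)
  have "unit_factor a = lead_coeff (primitive_part m) * lead_coeff (primitive_part s)"
    using * unfolding lead_coeff_mult lead_coeff_smult q(2) by simp
  moreover have "is_unit (unit_factor a)"
    using a by (rule unit_factor_is_unit)
  ultimately have "is_unit (lead_coeff (primitive_part m))"
    by (metis dvd_mult_left)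
  \<comment> \<open>\<open>e\<close> is the sign that turns \<open>primitive_part m\<close> into a
    monic polynomial.\<close>
  then obtain e where e: "1 = lead_coeff (primitive_part m) * e"
    unfolding dvd_def ..
  have "Polynomial.smult (content m) (primitive_part m) = m" by simp
  then have "of_int (content m) * poly (map_poly of_int (primitive_part m)) x = 0"
    using m unfolding S_def by (metis of_int_hom.map_poly_hom_smult poly_smult)
  then have "poly (map_poly of_int (primitive_part m)) x = 0"
    using m by (simp add: S_def)
  then have "poly (map_poly of_int (Polynomial.smult e (primitive_part m))) x = 0"
    by (simp add: of_int_hom.map_poly_hom_smult)
  moreover have "lead_coeff (Polynomial.smult e (primitive_part m)) = 1"
    using e unfolding lead_coeff_smult by (simp only: mult.commute)
  moreover have "degree (Polynomial.smult e (primitive_part m)) = degree m"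
    using e by auto
  ultimately have "alg_int_degree x \<le> degree m"
    unfolding alg_int_degree_def by (intro Least_le) blast
  then show ?thesis
    using m_le[of p] p by (simp add: S_def)
qed

text \<open>The nonzero family \<open>x\<close> is an eigenvector of an integer matrix, so
  \<open>l\<close> is a root of its characteristic polynomial, which is monic with integer
  coefficients.\<close>

lemma algebraic_int_eigenvalue:
  fixes a :: "'b \<Rightarrow> 'b \<Rightarrow> int" and x :: "'b \<Rightarrow> 'a::field_char_0"
  assumes I: "finite I" and eq: "\<And>i. i \<in> I \<Longrightarrow> (\<Sum>j\<in>I. of_int (a i j) * x j) = l * x i"
    and nz: "\<exists>i\<in>I. x i \<noteq> 0"
  shows "algebraic_int l"
proof -
  define n where "n = card I"
  obtain f where f: "bij_betw f {0..<n} I"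
    using ex_bij_betw_nat_finite[OF I] unfolding n_def by blast
  define A where "A = Matrix.mat n n (\<lambda>(i, j). a (f i) (f j))"
  define v where "v = Matrix.vec n (\<lambda>i. x (f i))"
  have A: "A \<in> carrier_mat n n" by (simp add: A_def)
  let ?A = "map_mat of_int A :: 'a mat"
  have sum: "(\<Sum>j\<in>{0..<n}. g (f j)) = (\<Sum>j\<in>I. g j)" for g :: "'b \<Rightarrow> 'a"
    by (rule sum.reindex_bij_betw[OF f])
  have fI: "i < n \<Longrightarrow> f i \<in> I" for i
    using f by (auto simp: bij_betw_def)
  have "v \<noteq> 0\<^sub>v n"
  proof
    assume v0: "v = 0\<^sub>v n"
    obtain i where i: "i \<in> I" "x i \<noteq> 0" using nz by blast
    then obtain j where "j < n" "i = f j" using f by (auto simp: bij_betw_def)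
    then show False using v0 i by (metis v_def index_vec index_zero_vec(1))
  qed
  moreover have "?A *\<^sub>v v = l \<cdot>\<^sub>v v"
    by (rule eq_vecI)
      (simp_all add: A_def v_def scalar_prod_def sum[of "\<lambda>j. of_int (a (f _) j) * x j"] eq fI)
  moreover have "v \<in> carrier_vec n" by (simp add: v_def)
  ultimately have "eigenvalue ?A l"
    using A unfolding eigenvalue_def eigenvector_def by auto
  then have "poly (char_poly ?A) l = 0"
    using eigenvalue_root_char_poly[of ?A n] A by simp
  then have "poly (map_poly of_int (char_poly A)) l = 0"
    by (simp add: of_int_hom.char_poly_hom[OF A])
  moreover have "lead_coeff (char_poly A) = 1"
    using degree_monic_char_poly[OF A] by simp
  ultimately show ?thesis
    by (auto simp: algebraic_int_altdef_ipoly)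
qed

lemma rational_relation_imp_int_poly:
  fixes u :: "nat \<Rightarrow> rat" and l :: "'a::field_char_0"
  assumes rel: "(\<Sum>j<n. of_rat (u j) * l ^ j) = 0" and k: "k < n" "u k \<noteq> 0"
  shows "\<exists>p :: int poly. p \<noteq> 0 \<and> degree p < n \<and> poly (map_poly of_int p) l = 0"
proof -
  \<comment> \<open>The product of all denominators serves as a common denominator; multiplying by
    it keeps the coefficient at \<open>k\<close> nonzero.\<close>
  define d where "d = (\<Prod>j<n. snd (quotient_of (u j)))"
  have d: "d \<noteq> 0"
    using quotient_of_denom_pos' by (auto simp: d_def) (metis less_irrefl)
  have "\<exists>c. of_int d * u j = of_int c" if "j < n" for j
  proof -
    have "snd (quotient_of (u j)) dvd d"
      unfolding d_def using that dvd_prodI[of "{..<n}" j "\<lambda>j. snd (quotient_of (u j))"] by simp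
    then obtain e where e: "d = snd (quotient_of (u j)) * e" by (auto elim: dvdE)
    have "u j = of_int (fst (quotient_of (u j))) / of_int (snd (quotient_of (u j)))"
      by (rule quotient_of_div) simp
    moreover have "snd (quotient_of (u j)) \<noteq> 0"
      using quotient_of_denom_pos'[of "u j"] by simp
    ultimately have "of_int d * u j = of_int (fst (quotient_of (u j)) * e)"
      by (simp add: e field_simps)
    then show ?thesis by blast
  qed
  then obtain c where c: "\<And>j. j < n \<Longrightarrow> of_int d * u j = of_int (c j)" by metis
  define p where "p = (\<Sum>j<n. monom (c j) j)"
  have "coeff p k = c k"
    using k by (simp add: p_def coeff_sum)
  moreover have "c k \<noteq> 0"
    using c[OF k(1)] d k by auto
  moreover have "degree p < n"
    unfolding p_def using k by (intro degree_sum_less) (auto intro: le_less_trans[OF degree_monom_le])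
  moreover have "poly (map_poly of_int p) l = (\<Sum>j<n. of_int (c j) * l ^ j)"
    by (simp add: p_def of_int_poly_hom.hom_sum of_int_hom.map_poly_hom_monom poly_sum poly_monom)
  moreover have "\<dots> = (\<Sum>j<n. of_int d * (of_rat (u j) * l ^ j))"
  proof (rule sum.cong)
    fix j assume "j \<in> {..<n}"
    then have "(of_rat (of_int (c j)) :: 'a) = of_rat (of_int d * u j)" using c by simp
    then show "of_int (c j) * l ^ j = of_int d * (of_rat (u j) * l ^ j)"
      by (simp add: of_rat_mult)
  qed simp
  moreover have "\<dots> = 0"
    using rel by (simp flip: sum_distrib_left)
  ultimately show ?thesis by (intro exI[of _ p]) auto
qed

section \<open>Counting dimensions over the rationals\<close>

text \<open>A form of the tower law. The hypothesis on \<open>n\<close> makes the powers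
  \<open>l ^ j\<close> with \<open>j < n\<close> rationally independent; multiplied by a real basis
  \<open>C\<close> chosen among the \<open>y i\<close>, they stay independent over the rationals. By
  \<open>eq\<close> they all lie in the rational span of at most \<open>card I\<close>
  vectors.\<close>

lemma degree_times_dim_le_card:
  fixes a :: "'b \<Rightarrow> 'b \<Rightarrow> int" and y :: "'b \<Rightarrow> 'v::real_vector" and l :: real
  assumes I: "finite I" and eq: "\<And>i. i \<in> I \<Longrightarrow> (\<Sum>j\<in>I. of_int (a i j) *\<^sub>R y j) = l *\<^sub>R y i"
    and n: "\<And>p :: int poly. p \<noteq> 0 \<Longrightarrow> poly (map_poly of_int p) l = 0 \<Longrightarrow> n \<le> degree p"
  shows "n * dim (y ` I) \<le> card I"
proof -
  \<comment> \<open>The same type seen as a rational vector space; unprefixed notions remain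
    real.\<close>
  interpret Q: vector_space "\<lambda>(q::rat) (x::'v). of_rat q *\<^sub>R x"
    by unfold_locales (auto simp: scaleR_add_left scaleR_add_right of_rat_add of_rat_mult)
  have ind: "u k = 0" if "(\<Sum>j<n. of_rat (u j) * l ^ j) = 0" "k < n" for u k
    using rational_relation_imp_int_poly[OF that] n by force
  obtain C where C: "C \<subseteq> y ` I" "independent C" "card C = dim (y ` I)"
    by (rule basis_exists[of "y ` I"]) (rule that)
  have fC: "finite C" using C(1) I finite_surj by blast
  have l_span: "l *\<^sub>R z \<in> Q.span (y ` I)" if "z \<in> Q.span (y ` I)" for z
    using that
  proof (induction rule: Q.span_induct_alt)
    case base
    show ?case by (simp add: Q.span_zero)
  next
    case (step c w z)
    have "l *\<^sub>R y i \<in> Q.span (y ` I)" if i: "i \<in> I" for i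
    proof -
      have "(\<Sum>j\<in>I. of_rat (of_int (a i j)) *\<^sub>R y j) \<in> Q.span (y ` I)"
        by (intro Q.span_sum Q.span_scale Q.span_base imageI)
      then show ?thesis using eq[OF i] by simp
    qed
    then have "of_rat c *\<^sub>R (l *\<^sub>R w) + l *\<^sub>R z \<in> Q.span (y ` I)"
      using step by (intro Q.span_add Q.span_scale) auto
    then show ?case by (simp add: scaleR_add_right mult.commute)
  qed
  have pow: "l ^ j *\<^sub>R z \<in> Q.span (y ` I)" if "z \<in> C" for j z
  proof (induction j)
    case 0
    then show ?case using that C(1) by (auto intro: Q.span_base)
  next
    case (Suc j)
    then show ?case using l_span[of "l ^ j *\<^sub>R z"] by simp
  qed
  define g where "g = (\<lambda>(j, z). l ^ j *\<^sub>R (z::'v))"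
  \<comment> \<open>Grouping by \<open>z\<close> gives a real relation on \<open>C\<close>, so each
    inner sum over \<open>j\<close> vanishes; independence of the powers of \<open>l\<close> then
    kills each \<open>u (j, z)\<close>.\<close>
  have coeffs: "u (j, z) = 0"
    if "(\<Sum>s\<in>{..<n} \<times> C. of_rat (u s) *\<^sub>R g s) = 0" and jz: "j < n" "z \<in> C" for u j z
  proof -
    have "(\<Sum>z\<in>C. (\<Sum>j<n. of_rat (u (j, z)) * l ^ j) *\<^sub>R z)
        = (\<Sum>z\<in>C. \<Sum>j<n. of_rat (u (j, z)) *\<^sub>R g (j, z))"
      by (simp add: g_def scaleR_sum_left)
    also have "\<dots> = (\<Sum>s\<in>{..<n} \<times> C. of_rat (u s) *\<^sub>R g s)"
      by (subst sum.swap) (simp add: sum.cartesian_product)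
    finally have "(\<Sum>z\<in>C. (\<Sum>j<n. of_rat (u (j, z)) * l ^ j) *\<^sub>R z) = 0"
      using that(1) by simp
    then have "(\<Sum>j<n. of_rat (u (j, z)) * l ^ j) = 0"
      using independentD[OF C(2) fC subset_refl, of "\<lambda>z. \<Sum>j<n. of_rat (u (j, z)) * l ^ j"] jz(2)
      by simp
    then show ?thesis using ind[of "\<lambda>j. u (j, z)"] jz(1) by blast
  qed
  let ?S = "{..<n} \<times> C"
  have fS: "finite ?S" using fC by simp
  have inj: "inj_on g ?S"
  proof (rule inj_onI, rule ccontr)
    fix s t assume st: "s \<in> ?S" "t \<in> ?S" "g s = g t" "s \<noteq> t"
    \<comment> \<open>A collision of \<open>g\<close> would be a relation with coefficients 1 and
      -1, which \<open>coeffs\<close> excludes.\<close>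
    let ?u = "\<lambda>r. if r = s then 1 else if r = t then - 1 else 0 :: rat"
    have "(\<Sum>r\<in>?S. of_rat (?u r) *\<^sub>R g r) = (\<Sum>r\<in>{s, t}. of_rat (?u r) *\<^sub>R g r)"
      using st fS by (intro sum.mono_neutral_right) auto
    also have "\<dots> = 0" using st by simp
    finally have "(\<Sum>r\<in>?S. of_rat (?u r) *\<^sub>R g r) = 0" .
    from coeffs[OF this, of "fst s" "snd s"] st(1) show False by auto
  qed
  have "Q.independent (g ` ?S)"
  proof (rule Q.independent_if_scalars_zero)
    fix f x assume f: "(\<Sum>x\<in>g ` ?S. of_rat (f x) *\<^sub>R x) = 0" and x: "x \<in> g ` ?S"
    have "(\<Sum>s\<in>?S. of_rat (f (g s)) *\<^sub>R g s) = 0"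
      using f by (simp add: sum.reindex[OF inj])
    then show "f x = 0" using coeffs[of "\<lambda>s. f (g s)"] x by auto
  qed (use fS in simp)
  moreover have "g ` ?S \<subseteq> Q.span (y ` I)"
    using pow by (auto simp: g_def)
  ultimately have "card (g ` ?S) \<le> card (y ` I)"
    using Q.independent_span_bound[of "y ` I"] I by blast
  also have "\<dots> \<le> card I" by (rule card_image_le[OF I])
  finally show ?thesis
    using C(3) by (simp add: card_image[OF inj] card_cartesian_product)
qed

section \<open>Eigenvalues of lattice endomorphisms\<close>

lemma lattice_eigenvalue:
  fixes T :: "'v::real_vector \<Rightarrow> 'v" and v :: "'n::finite \<Rightarrow> 'v"
  assumes lat: "lattice_in V \<Gamma>" and T: "linear T" "T ` \<Gamma> \<subseteq> \<Gamma>"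
    and v: "inj v" "independent (range v)" "range v \<subseteq> V" and eig: "\<And>k. T (v k) = l *\<^sub>R v k"
  shows "algebraic_int l" and "alg_int_degree (of_real l) * CARD('n) \<le> dim V"
proof -
  obtain B where B: "finite B" "independent B" "span B = V"
    and G: "\<Gamma> = {\<Sum>b\<in>B. of_int (c b) *\<^sub>R b | c :: 'v \<Rightarrow> int. True}"
    using lat by (auto simp: lattice_in_def)
  have "\<exists>c :: 'v \<Rightarrow> int. T b = (\<Sum>b'\<in>B. of_int (c b') *\<^sub>R b')" if b: "b \<in> B" for b
  proof -
    have "(\<Sum>b'\<in>B. of_int (if b' = b then 1 else 0) *\<^sub>R b') = (\<Sum>b'\<in>B. if b' = b then b' else 0)"
      by (intro sum.cong) auto
    then have "(\<Sum>b'\<in>B. of_int (if b' = b then 1 else 0) *\<^sub>R b') = b"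
      using b B(1) by simp
    then have "b \<in> \<Gamma>"
      unfolding G by (intro CollectI exI[of _ "\<lambda>b'. if b' = b then 1 else 0"]) simp
    then show ?thesis using T(2) G by auto
  qed
  then obtain a :: "'v \<Rightarrow> 'v \<Rightarrow> int"
    where a: "\<And>b. b \<in> B \<Longrightarrow> T b = (\<Sum>b'\<in>B. of_int (a b b') *\<^sub>R b')" by metis
  define x where "x k = representation B (v k)" for k
  have x: "v k = (\<Sum>b\<in>B. x k b *\<^sub>R b)" for k
    unfolding x_def by (rule sum_representation_eq[symmetric]) (use B v(3) in auto)
  \<comment> \<open>Comparing coordinates in \<open>T (v k) = l *\<^sub>R v k\<close> sums over the
    first index of \<open>a\<close>, so the integer matrix used below is the transpose.\<close>
  have xeq: "(\<Sum>b\<in>B. of_int (a b b') * x k b) = l * x k b'" if b': "b' \<in> B" for k b'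
  proof -
    have "(\<Sum>b'\<in>B. (\<Sum>b\<in>B. of_int (a b b') * x k b) *\<^sub>R b')
        = (\<Sum>b\<in>B. x k b *\<^sub>R (\<Sum>b'\<in>B. of_int (a b b') *\<^sub>R b'))"
      by (simp add: scaleR_sum_left scaleR_sum_right mult.commute) (rule sum.swap)
    also have "\<dots> = T (v k)"
      by (simp add: x linear_sum[OF T(1)] linear_scale[OF T(1)] a)
    also have "\<dots> = (\<Sum>b'\<in>B. (l * x k b') *\<^sub>R b')"
      unfolding eig by (simp add: x scaleR_sum_right)
    finally have "(\<Sum>b'\<in>B. ((\<Sum>b\<in>B. of_int (a b b') * x k b) - l * x k b') *\<^sub>R b') = 0"
      by (simp add: scaleR_diff_left sum_subtractf)
    then show ?thesis
      using independentD[OF B(2,1) subset_refl,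
          of "\<lambda>b'. (\<Sum>b\<in>B. of_int (a b b') * x k b) - l * x k b'"] b' by simp
  qed
  show alg: "algebraic_int l"
  \<comment> \<open>Any single eigenvector suffices for integrality, hence the arbitrary index
    \<open>undefined\<close>.\<close>
  proof (rule algebraic_int_eigenvalue[OF B(1), of "\<lambda>b' b. a b b'" "x undefined"])
    show "\<exists>b\<in>B. x undefined b \<noteq> 0"
    proof (rule ccontr)
      assume "\<not> ?thesis"
      then have "v undefined = 0" unfolding x by (intro sum.neutral) auto
      then have "0 \<in> range v" by (metis rangeI)
      then show False using v(2) dependent_zero by blast
    qed
  qed (rule xeq)
  \<comment> \<open>The columns of the coefficient matrix whose rows are the coordinates of the
    \<open>v k\<close>.\<close>
  define y where "y b = (\<chi> k. x k b)" for b
  have "span (y ` B) = UNIV"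
  proof (rule ccontr)
    assume "span (y ` B) \<noteq> UNIV"
    then obtain w where w: "w \<noteq> 0" "\<And>z. z \<in> span (y ` B) \<Longrightarrow> inner w z = 0"
      using span_not_UNIV_orthogonal by blast
    \<comment> \<open>Row rank equals column rank: a vector \<open>w\<close> orthogonal to all
      columns is a linear relation between the rows, hence between the independent
      \<open>v k\<close>.\<close>
    have "(\<Sum>k\<in>UNIV. vec_nth w k *\<^sub>R v k) = (\<Sum>b\<in>B. inner w (y b) *\<^sub>R b)"
      by (simp add: x y_def inner_vec_def scaleR_sum_left scaleR_sum_right) (rule sum.swap)
    also have "\<dots> = 0" using w(2) by (simp add: span_base)
    finally have "(\<Sum>z\<in>range v. vec_nth w (inv_into UNIV v z) *\<^sub>R z) = 0"
      using v(1) by (simp add: sum.reindex)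
    then have "\<forall>z\<in>range v. vec_nth w (inv_into UNIV v z) = 0"
      using independentD[OF v(2) finite_imageI subset_refl, of "\<lambda>z. vec_nth w (inv_into UNIV v z)"] by auto
    then have "w = 0" using v(1) by (simp add: Finite_Cartesian_Product.vec_eq_iff)
    then show False using w(1) by simp
  qed
  then have "dim (y ` B) = CARD('n)"
    by (metis dim_span dim_UNIV DIM_cart DIM_real mult.right_neutral)
  moreover have "alg_int_degree (of_real l) * dim (y ` B) \<le> card B"
  proof (rule degree_times_dim_le_card[OF B(1), of "\<lambda>b' b. a b b'"])
    show "(\<Sum>b\<in>B. of_int (a b b') *\<^sub>R y b) = l *\<^sub>R y b'" if "b' \<in> B" for b'
      using xeq[OF that] by (simp add: Finite_Cartesian_Product.vec_eq_iff y_def)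
    fix p :: "int poly"
    assume p: "p \<noteq> 0" "poly (map_poly of_int p) l = 0"
    \<comment> \<open>The degree is defined for complex numbers, while the dimension count takes
      place over the reals.\<close>
    have "poly (map_poly of_int p) (complex_of_real l) = of_real (poly (map_poly of_int p) l)"
      by (simp add: poly_altdef)
    then show "alg_int_degree (of_real l) \<le> degree p"
      using alg_int_degree_le_degree[of "of_real l" p] alg p by simp
  qed
  ultimately show "alg_int_degree (of_real l) * CARD('n) \<le> dim V"
    using B by (metis dim_span dim_eq_card_independent)
qed

text \<open>Lattice vectors have integer coordinates, so a nonzero coordinate of \<open>v\<close>
  exhibits \<open>l\<close> as a quotient of integers.\<close>

lemma lattice_eigenvector_imp_eigenvalue_rational:
  fixes v :: "'v::real_vector"
  assumes lat: "lattice_in V \<Gamma>" and v: "v \<in> \<Gamma>" "v \<noteq> 0" "l *\<^sub>R v \<in> \<Gamma>"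
  shows "l \<in> \<rat>"
proof -
  obtain B where B: "finite B" "independent B"
    and G: "\<Gamma> = {\<Sum>b\<in>B. of_int (c b) *\<^sub>R b | c :: 'v \<Rightarrow> int. True}"
    using lat by (auto simp: lattice_in_def)
  obtain c d :: "'v \<Rightarrow> int" where c: "v = (\<Sum>b\<in>B. of_int (c b) *\<^sub>R b)"
    and d: "l *\<^sub>R v = (\<Sum>b\<in>B. of_int (d b) *\<^sub>R b)"
    using v G by auto
  have "(\<Sum>b\<in>B. (l * of_int (c b) - of_int (d b)) *\<^sub>R b) = 0"
    using d by (simp add: c scaleR_sum_right scaleR_diff_left sum_subtractf)
  then have eq: "l * of_int (c b) = of_int (d b)" if "b \<in> B" for b
    using independentD[OF B(2,1) subset_refl, of "\<lambda>b. l * of_int (c b) - of_int (d b)"] that by simp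
  have "\<exists>b\<in>B. c b \<noteq> 0"
  proof (rule ccontr)
    assume "\<not> ?thesis"
    then have "v = 0" unfolding c by (intro sum.neutral) auto
    then show False using v(2) by simp
  qed
  then obtain b where b: "b \<in> B" "c b \<noteq> 0" by blast
  then have "l = of_int (d b) / of_int (c b)"
    using eq[of b] by (simp add: field_simps)
  then show ?thesis by simp
qed

section \<open>Application to K3 models\<close>

text \<open>Excludes an empty intersection, so that one different from \<open>{0}\<close> contains a
  nonzero vector.\<close>

lemma zero_in_Pi_space_RR_lattice:
  assumes K: "K3_model K"
  shows "0 \<in> Pi_space K \<inter> RR_lattice K"
proof -
  have lat: "lattice_in (Vspace K) (RR_lattice K)"
    using K unfolding K3_model_def RR_structure_def even_unimodular_def by blast
  then have G: "0 \<in> RR_lattice K" and V: "0 \<in> Vspace K"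
    by (auto simp: lattice_in_def span_zero intro!: exI[of _ "\<lambda>_. 0"])
  have "Jm A i 0 0 = 0" if "A \<in> {lft K, rgt K}" "i \<in> {1..3}" for A i
  proof -
    have "Jm A i 0 (0 + 0) = Jm A i 0 0 + Jm A i 0 0"
      using n4_algebraD(2)[OF n4_K[OF K that(1)] that(2)] unfolding clinear_op_def by blast
    then show ?thesis by simp
  qed
  then show ?thesis using G V by (simp add: Pi_space_def)
qed

theorem claim2:
  fixes K :: "('h::real_vector, 'd) sigma_model"
  assumes "K3_model K"
  shows "(\<forall>\<L>\<in>Top K. algebraic_int (qdim K \<L>) \<and> alg_int_degree (qdim K \<L>) \<le> 6) \<and>
         (Pi_space K \<inter> RR_lattice K \<noteq> {0} \<longrightarrow> (\<forall>\<L>\<in>Top K. qdim K \<L> \<in> \<int>))"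
proof -
  have RR: "RR_structure K" and TD: "topological_defects K"
    using assms by (simp_all add: K3_model_def)
  have lat: "lattice_in (Vspace K) (RR_lattice K)"
    and dim: "dim (Vspace K) = 24" "dim (Pi_space K) = 4"
    using RR unfolding RR_structure_def even_unimodular_def by blast+
  obtain E where E: "E \<subseteq> Pi_space K" "independent E" "card E = 4"
    by (rule basis_exists[of "Pi_space K"]) (rule that, simp_all add: dim(2))
  have "finite E" using E(3) card.infinite by fastforce
  \<comment> \<open>Indexing by the type \<open>4\<close> provides the family required by
    \<open>lattice_eigenvalue\<close>.\<close>
  then obtain v :: "4 \<Rightarrow> 'h" where v: "bij_betw v UNIV E"
    using finite_same_card_bij[of "UNIV :: 4 set" E] E(3) by auto
  have main: "algebraic_int (qdim K d) \<and> alg_int_degree (qdim K d) \<le> 6 \<and>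
      (Pi_space K \<inter> RR_lattice K \<noteq> {0} \<longrightarrow> qdim K d \<in> \<int>)" if d: "d \<in> Top K" for d
  proof -
    have dd: "d \<in> defects K" by (rule Top_defect(1)[OF assms d])
    then have "qdim K d \<in> \<real>" using TD unfolding topological_defects_def by blast
    then obtain l where l: "qdim K d = of_real l" by (auto elim: Reals_cases)
    have lin: "linear (hat K d)"
      using Top_defect(3)[OF assms d dd] hat_scaleR[OF assms d dd]
      by (intro linearI) (auto simp: clinear_op_def)
    have TG: "hat K d ` RR_lattice K \<subseteq> RR_lattice K"
      by (rule Top_RR_lattice[OF assms d])
    have eig: "hat K d w = l *\<^sub>R w" if "w \<in> Pi_space K" for w
      using Top_Pi[OF assms d that] l pre_hilbertD(1)[OF hilb[OF assms d]] by simp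
    have vE: "inj v" "range v = E" using v by (auto simp: bij_betw_def)
    have EV: "E \<subseteq> Vspace K" using E(1) by (auto simp: Pi_space_def)
    have evk: "hat K d (v k) = l *\<^sub>R v k" for k
      using eig E(1) vE(2) by blast
    have "algebraic_int l" "alg_int_degree (of_real l) * CARD(4) \<le> dim (Vspace K)"
      by (rule lattice_eigenvalue[OF lat lin TG vE(1)]; use vE E EV evk in simp)+
    moreover have "l \<in> \<rat>" if nz: "Pi_space K \<inter> RR_lattice K \<noteq> {0}"
    proof -
      obtain w where w: "w \<in> Pi_space K" "w \<in> RR_lattice K" "w \<noteq> 0"
        using nz zero_in_Pi_space_RR_lattice[OF assms] by blast
      moreover have "l *\<^sub>R w \<in> RR_lattice K" using TG w eig by force
      ultimately show ?thesis
        by (intro lattice_eigenvector_imp_eigenvalue_rational[OF lat])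
    qed
    \<comment> \<open>The bound 6 is 24 / 4, and a rational algebraic integer is an integer.\<close>
    ultimately show ?thesis
      using rational_algebraic_int_is_int[of l] dim(1) by (auto simp: l)
  qed
  then show ?thesis by blast
qed

end
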